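(* In the ad-hoc radio network model with transmission acknowledgements (defined in the context), there is a deterministic protocol such that, for every acyclic directed graph $G$ with $n$ vertices, labels from $\{0,1,\dots,n-1\}$, and a designated target node $t$ reachable from all other nodes, the protocol completes information gathering on $G$ within $O(n\log^2 n)$ time steps.
   Context: Ad-hoc radio network model: the network is a directed graph $G$ on $n$ nodes, each node having a distinct label from $\{0,1,\dots,n-1\}$; nodes know $n$ and their own label, but the topology of $G$ is unknown to them. Time proceeds in synchronous discrete steps $0,1,2,\dots$, and all nodes start simultaneously at step $0$. In each step each node is either transmitting (sending one message) or receiving. If node $u$ transmits in a step, the message reaches all out-neighbors of $u$; a receiving node $v$ receives a message in that step if and only if exactly one in-neighbor of $v$ transmits in that step; otherwise $v$ receives nothing and cannot distinguish a collision from silence. Messages have unbounded size. Acknowledgements: immediately after each of its transmissions, the transmitting node receives a single bit indicating whether that transmission was successfully received by at least one of its out-neighbors (it learns neither which nor how many). A deterministic protocol specifies each node's transmissions as a function of its label, $n$, the messages it has received, and the acknowledgement bits it has received. Information gathering: each node initially holds a unique rumor; there is a designated target node $t$ reachable by directed paths from all nodes; the task is completed when $t$ holds all $n$ rumors. The running time is the number of steps until completion, in the worst case over all such graphs and labelings. *)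

theory Defs
  imports Complex_Main "HOL-Library.Landau_Symbols"
begin

text \<open>
  The $n$ nodes carry distinct labels from $\{0,\dots,n-1\}$, so a node is identified with its
  label and the network is a relation on \<^term>\<open>{..<n}\<close>. Ranging over all such relations
  covers all graphs together with all labelings. The rumor initially held by node \<^term>\<open>v\<close> is
  identified with \<^term>\<open>v\<close>.

  A message carries a set of rumors, and besides these an arbitrary finite amount of further data.
\<close>

datatype message = Message (rumors: "nat set") (content: "nat list")

datatype action = Receive | Transmit message

text \<open>What a node learns in one step; \<open>Silence\<close> covers both silence and collision.\<close>

datatype observation = Silence | Received message | Ack bool

text \<open>
  A deterministic protocol maps $n$, the label of a node and the node's observations so far
  (oldest first, one per elapsed step) to the action of the node in the next step.
\<close>

type_synonym protocol = "nat \<Rightarrow> nat \<Rightarrow> observation list \<Rightarrow> action"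

definition held :: "nat \<Rightarrow> observation list \<Rightarrow> nat set" where
  "held v h = insert v (\<Union>{rumors m |m. Received m \<in> set h})"

text \<open>
  Rumors are opaque: a node can only pass on rumors it holds, so any other rumors are dropped from
  the message chosen by the protocol. In the following definitions \<^term>\<open>H\<close> assigns to every
  node its observations so far.
\<close>

definition sent :: "protocol \<Rightarrow> nat \<Rightarrow> (nat \<Rightarrow> observation list) \<Rightarrow> nat \<Rightarrow> message option" where
  "sent P n H v = (case P n v (H v) of
      Receive \<Rightarrow> None
    | Transmit m \<Rightarrow> Some (Message (rumors m \<inter> held v (H v)) (content m)))"

definition transmits :: "protocol \<Rightarrow> nat \<Rightarrow> (nat \<Rightarrow> observation list) \<Rightarrow> nat \<Rightarrow> bool" where
  "transmits P n H v \<longleftrightarrow> sent P n H v \<noteq> None"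

text \<open>The transmission of \<^term>\<open>u\<close> is successfully received by \<^term>\<open>v\<close>.\<close>

definition delivers ::
  "protocol \<Rightarrow> nat \<Rightarrow> (nat \<times> nat) set \<Rightarrow> (nat \<Rightarrow> observation list) \<Rightarrow> nat \<Rightarrow> nat \<Rightarrow> bool" where
  "delivers P n E H u v \<longleftrightarrow>
     \<not> transmits P n H v \<and> {w. (w, v) \<in> E \<and> transmits P n H w} = {u}"

definition observe ::
  "protocol \<Rightarrow> nat \<Rightarrow> (nat \<times> nat) set \<Rightarrow> (nat \<Rightarrow> observation list) \<Rightarrow> nat \<Rightarrow> observation" where
  "observe P n E H v =
     (if transmits P n H v then Ack (\<exists>w. delivers P n E H v w)
      else if \<exists>u. delivers P n E H u v
        then Received (the (sent P n H (THE u. delivers P n E H u v)))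
      else Silence)"

text \<open>The observations of every node during the first \<^term>\<open>k\<close> steps.\<close>

primrec history :: "protocol \<Rightarrow> nat \<Rightarrow> (nat \<times> nat) set \<Rightarrow> nat \<Rightarrow> nat \<Rightarrow> observation list" where
  "history P n E 0 = (\<lambda>v. [])"
| "history P n E (Suc k) =
     (\<lambda>v. history P n E k v @ [observe P n E (history P n E k) v])"

definition gathers_within ::
  "protocol \<Rightarrow> nat \<Rightarrow> (nat \<times> nat) set \<Rightarrow> nat \<Rightarrow> nat \<Rightarrow> bool" where
  "gathers_within P n E t T \<longleftrightarrow> (\<exists>k\<le>T. {..<n} \<subseteq> held t (history P n E k t))"

definition acyclic_network :: "nat \<Rightarrow> (nat \<times> nat) set \<Rightarrow> nat \<Rightarrow> bool" where
  "acyclic_network n E t \<longleftrightarrow>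
     E \<subseteq> {..<n} \<times> {..<n} \<and> acyclic E \<and> t < n \<and> (\<forall>v<n. (v, t) \<in> E\<^sup>*)"

end

theory Submission
  imports Defs "HOL-Library.FuncSet"
begin

text \<open>
  Let every node transmit alone twice, so that each node learns its in-neighbours and theirs. Call
  \<open>v\<close> a nearest out-neighbour of \<open>u\<close> if no in-neighbour of \<open>v\<close> is an out-neighbour of \<open>u\<close>; by
  acyclicity one exists for every \<open>u\<close> other than \<open>t\<close>. An out-neighbour of \<open>u\<close> can refuse a message
  of \<open>u\<close> by transmitting itself, and such a refusal never disturbs a nearest out-neighbour. Hence an
  acknowledgement tells \<open>u\<close> whether a nearest out-neighbour with prescribed low-order label bits
  exists, and \<open>u\<close> finds the label of one of them, its parent, bit by bit in \<open>O(log n)\<close> queries.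

  The parents form a tree towards \<open>t\<close> in which every node knows its children. A node becomes active
  when it has heard all its children and sends all it holds until its parent has received it;
  here too every other receiver refuses, so that an acknowledgement can only come from the
  parent. Whenever exactly one active node transmits, it succeeds. A union bound over all ways in
  which activity periods can be arranged shows that some fixed sequence of \<open>O(n log\<^sup>2 n)\<close>
  transmission sets, drawn at random with random density, isolates the active nodes one after the
  other on every network.
\<close>

subsection \<open>Schedules isolating active nodes\<close>

definition isolates :: "nat set \<Rightarrow> nat set \<Rightarrow> bool" where
  "isolates S A \<longleftrightarrow> (\<exists>u. S \<inter> A = {u})"

text \<open>In a sample \<open>(i, f)\<close> each node is selected with density \<open>1 / 2 ^ i\<close>.\<close>

definition samples :: "nat \<Rightarrow> nat \<Rightarrow> (nat \<times> (nat \<Rightarrow> nat)) set" where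
  "samples n l = {1..l} \<times> ({..<n} \<rightarrow>\<^sub>E {..<2 ^ l})"

definition sample_set :: "nat \<Rightarrow> nat \<Rightarrow> nat \<times> (nat \<Rightarrow> nat) \<Rightarrow> nat set" where
  "sample_set n l = (\<lambda>(i, f). {x. x < n \<and> f x < 2 ^ (l - i)})"

section \<open>Counting isolating samples\<close>

lemma finite_samples: "finite (samples n l)"
  by (simp add: samples_def finite_PiE)

lemma card_samples: "card (samples n l) = l * (2 ^ l) ^ n"
  by (simp add: samples_def card_cartesian_product card_PiE)

text \<open>For \<open>a\<close> active nodes this supplies a density \<open>1 / 2 ^ i\<close>
  between \<open>1 / (4 * a)\<close> and \<open>1 / (2 * a)\<close>.\<close>

lemma power_of_two_bracket:
  fixes a l :: nat
  assumes "1 \<le> a" "2 * a \<le> 2 ^ l"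
  obtains i where "1 \<le> i" "i \<le> l" "2 * a \<le> 2 ^ i" "2 ^ i \<le> 4 * a"
proof -
  define i where "i = (LEAST i. 2 * a \<le> 2 ^ i)"
  have i: "2 * a \<le> 2 ^ i" unfolding i_def using assms(2) by (rule LeastI)
  have il: "i \<le> l" unfolding i_def using assms(2) by (rule Least_le)
  have "i \<noteq> 0" using i assms(1) by (cases i) auto
  then obtain j where j: "i = Suc j" using not0_implies_Suc by blast
  then have "\<not> 2 * a \<le> 2 ^ j" using not_less_Least[of j "\<lambda>i. 2 * a \<le> 2 ^ i"] i_def by simp
  then have "2 ^ i \<le> 4 * a" using j by simp
  then show ?thesis using that[of i] i il j by simp
qed

text \<open>With \<open>d = m / M\<close>, selecting \<open>x\<close> but no other member of
  \<open>A\<close> has probability \<open>d * (1 - d) ^ (card A - 1)\<close>. Bernoulli's inequality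
  bounds the power below by \<open>1 / 2\<close>, because
  \<open>card A * d \<le> 1 / 2\<close>.\<close>

lemma isolating_functions_count:
  fixes n m M :: nat
  assumes "A \<subseteq> {..<n}" "x \<in> A" "m \<le> M" "0 < M" "2 * card A * m \<le> M"
  shows "real M ^ n * (real m / real M) / 2 \<le>
    real (card (PiE {..<n} (\<lambda>y. if y = x then {..<m} else if y \<in> A then {m..<M} else {..<M})))"
proof -
  define d where "d = real m / real M"
  have fin: "finite A" using assms(1) finite_subset by blast
  have d: "0 \<le> d" "d \<le> 1" using assms by (auto simp: d_def)
  have ad: "real (card A) * d \<le> 1 / 2"
  proof -
    have "2 * real (card A) * real m \<le> real M"
      using assms(5) by (metis of_nat_le_iff of_nat_mult of_nat_numeral)
    then show ?thesis using assms(4) by (simp add: d_def field_simps)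
  qed
  have "real (card (PiE {..<n} (\<lambda>y. if y = x then {..<m} else if y \<in> A then {m..<M} else {..<M})))
      = (\<Prod>y<n. real (card (if y = x then {..<m} else if y \<in> A then {m..<M} else {..<M})))"
    by (simp add: card_PiE)
  also have "\<dots> = (\<Prod>y<n. real M * (if y \<in> A then if y = x then d else 1 - d else 1))"
    using assms by (intro prod.cong) (auto simp: d_def field_simps of_nat_diff)
  also have "\<dots> = real M ^ n * (\<Prod>y<n. if y \<in> A then if y = x then d else 1 - d else 1)"
    by (simp add: prod.distrib)
  also have "(\<Prod>y<n. if y \<in> A then if y = x then d else 1 - d else 1)
      = (\<Prod>y\<in>A. if y = x then d else 1 - d)"
    using assms(1) by (simp add: prod.If_cases Int_absorb1)
  also have "\<dots> = d * (1 - d) ^ (card A - 1)"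
    using fin assms(2) by (simp add: prod.remove card_Diff_singleton)
  finally have eq: "real (card (PiE {..<n} (\<lambda>y. if y = x then {..<m} else if y \<in> A then {m..<M}
      else {..<M}))) = real M ^ n * (d * (1 - d) ^ (card A - 1))" .
  have "1 / 2 \<le> 1 - real (card A - 1) * d"
    using ad d by (smt (verit) diff_le_self mult_right_mono of_nat_mono field_sum_of_halves)
  also have "\<dots> \<le> (1 - d) ^ (card A - 1)"
    using Bernoulli_inequality[of "- d" "card A - 1"] d by simp
  finally have "d * (1 / 2) \<le> d * (1 - d) ^ (card A - 1)"
    using d by (intro mult_left_mono)
  then have "real M ^ n * (d * (1 / 2)) \<le> real M ^ n * (d * (1 - d) ^ (card A - 1))"
    by (rule mult_left_mono) simp
  then show ?thesis unfolding eq d_def by simp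
qed

text \<open>One of the \<open>l\<close> densities \<open>d\<close> fits \<open>card A\<close>. At
  that density the events isolating distinct members of \<open>A\<close> are disjoint and have
  probability at least \<open>d / 2\<close> each. Since \<open>card A * d \<ge> 1 / 4\<close>, they
  add up to at least \<open>1 / 8\<close>.\<close>

lemma isolating_samples_count:
  assumes "A \<subseteq> {..<n}" "A \<noteq> {}" "2 * n \<le> 2 ^ l"
  shows "real (card (samples n l)) / (8 * real l)
    \<le> real (card {s \<in> samples n l. isolates (sample_set n l s) A})"
proof -
  have fin: "finite A" using assms(1) finite_subset by blast
  define a where "a = card A"
  have a: "1 \<le> a" "a \<le> n"
    using assms fin card_mono[of "{..<n}" A] by (auto simp: a_def card_gt_0_iff Suc_le_eq)
  obtain i where i: "1 \<le> i" "i \<le> l" "2 * a \<le> 2 ^ i" "2 ^ i \<le> 4 * a"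
    using power_of_two_bracket[of a l] a assms(3) by (metis le_trans mult_le_mono2)
  define m M :: nat where "m = 2 ^ (l - i)" and "M = 2 ^ l"
  define B where "B x = PiE {..<n} (\<lambda>y. if y = x then {..<m} else if y \<in> A then {m..<M} else {..<M})" for x
  have mM: "m * 2 ^ i = M" "m \<le> M" "0 < M"
    using i by (auto simp: m_def M_def power_add[symmetric])
  have "2 * a * m \<le> M" using mM(1) i(3) by (metis mult.commute mult_le_mono2)
  then have cardB: "real M ^ n * (real m / real M) / 2 \<le> real (card (B x))" if "x \<in> A" for x
    unfolding B_def using isolating_functions_count[of A n x m M] assms that mM by (simp add: a_def)
  have finB: "finite (B x)" for x unfolding B_def by (intro finite_PiE) auto
  have disj: "B x \<inter> B y = {}" if "x \<in> A" "y \<in> A" "x \<noteq> y" for x y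
  proof (rule ccontr)
    assume "B x \<inter> B y \<noteq> {}"
    then obtain f where f: "f \<in> B x" "f \<in> B y" by blast
    have "x < n" using that assms by auto
    then have "f x \<in> {..<m}" "f x \<in> {m..<M}"
      using PiE_mem[OF f(1)[unfolded B_def], of x] PiE_mem[OF f(2)[unfolded B_def], of x] that
      by auto
    then show False by simp
  qed
  have sub: "Pair i ` (\<Union>x\<in>A. B x) \<subseteq> {s \<in> samples n l. isolates (sample_set n l s) A}"
  proof
    fix s assume "s \<in> Pair i ` (\<Union>x\<in>A. B x)"
    then obtain x f where s: "s = (i, f)" "x \<in> A" "f \<in> B x" by blast
    have xn: "x < n" using s assms by auto
    have f: "f y \<in> (if y = x then {..<m} else if y \<in> A then {m..<M} else {..<M})" if "y < n" for y
      using PiE_mem[OF s(3)[unfolded B_def], of y] that by simp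
    have "f \<in> {..<n} \<rightarrow>\<^sub>E {..<M}"
    proof (rule PiE_I)
      fix y assume "y \<in> {..<n}"
      then show "f y \<in> {..<M}" using f[of y] mM(2) by (auto split: if_splits)
    next
      fix y assume "y \<notin> {..<n}"
      then show "f y = undefined" using PiE_arb[OF s(3)[unfolded B_def]] by simp
    qed
    then have "s \<in> samples n l" using s i by (simp add: samples_def M_def)
    moreover have "sample_set n l s \<inter> A = {x}"
      using s(1,2) xn f assms(1) unfolding sample_set_def m_def[symmetric] by (force simp: m_def[symmetric] split: if_splits)
    ultimately show "s \<in> {s \<in> samples n l. isolates (sample_set n l s) A}"
      by (auto simp: isolates_def)
  qed
  have "real (card (samples n l)) / (8 * real l) = real M ^ n / 8"
    using i by (simp add: card_samples M_def)
  also have "\<dots> \<le> real a * (real M ^ n * (real m / real M) / 2)"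
  proof -
    have "real M = real m * 2 ^ i" using mM(1) by (metis of_nat_mult of_nat_numeral of_nat_power)
    moreover have "0 < m" by (simp add: m_def)
    ultimately have "real m / real M = 1 / 2 ^ i" by simp
    moreover have "(2::real) ^ i \<le> 4 * real a"
      using i(4) by (metis of_nat_le_iff of_nat_mult of_nat_numeral of_nat_power)
    ultimately have "1 / 4 \<le> real a * (real m / real M)"
      by (simp only:) (simp add: field_simps)
    then have "real M ^ n * (1 / 4) \<le> real M ^ n * (real a * (real m / real M))"
      by (intro mult_left_mono) auto
    then show ?thesis by (simp add: algebra_simps)
  qed
  also have "\<dots> = (\<Sum>x\<in>A. real M ^ n * (real m / real M) / 2)" by (simp add: a_def)
  also have "\<dots> \<le> (\<Sum>x\<in>A. real (card (B x)))" by (intro sum_mono cardB)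
  also have "\<dots> = real (card (\<Union>x\<in>A. B x))"
    using card_UN_disjoint[OF fin, of B] finB disj by simp
  also have "\<dots> = real (card (Pair i ` (\<Union>x\<in>A. B x)))"
    by (simp add: card_image inj_on_def)
  also have "\<dots> \<le> real (card {s \<in> samples n l. isolates (sample_set n l s) A})"
    using sub finite_samples by (intro of_nat_mono card_mono) auto
  finally show ?thesis .
qed

section \<open>Derandomisation by averaging\<close>

text \<open>Averaged over \<open>Q\<close>, each object is missed with frequency at most
  \<open>1 - q\<close>, and some \<open>s\<close> does no worse than the average.\<close>

lemma exists_below_average:
  fixes w :: "'a \<Rightarrow> real" and q :: real
  assumes "finite Q" "Q \<noteq> {}" "finite C" "\<And>a. a \<in> C \<Longrightarrow> 0 \<le> w a"
    and "\<And>a. a \<in> C \<Longrightarrow> q * real (card Q) \<le> real (card {s \<in> Q. h s a})"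
  obtains s where "s \<in> Q" "(\<Sum>a\<in>{a \<in> C. \<not> h s a}. w a) \<le> (1 - q) * (\<Sum>a\<in>C. w a)"
proof -
  have "\<exists>s\<in>Q. (\<Sum>a\<in>{a \<in> C. \<not> h s a}. w a) \<le> (1 - q) * (\<Sum>a\<in>C. w a)"
  proof (rule ccontr)
    assume "\<not> ?thesis"
    then have "(\<Sum>s\<in>Q. (1 - q) * (\<Sum>a\<in>C. w a)) < (\<Sum>s\<in>Q. \<Sum>a\<in>{a \<in> C. \<not> h s a}. w a)"
      using assms(1,2) by (intro sum_strict_mono) auto
    also have "\<dots> = (\<Sum>s\<in>Q. \<Sum>a\<in>C. if h s a then 0 else w a)"
      using assms(3) by (auto simp: sum.inter_filter intro!: sum.cong[OF refl, of Q] sum.cong[OF refl, of C])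
    also have "\<dots> = (\<Sum>a\<in>C. \<Sum>s\<in>Q. if h s a then 0 else w a)" by (rule sum.swap)
    also have "\<dots> \<le> (\<Sum>a\<in>C. (1 - q) * real (card Q) * w a)"
    proof (rule sum_mono)
      fix a assume a: "a \<in> C"
      have "(\<Sum>s\<in>Q. if h s a then 0 else w a) = (\<Sum>s\<in>Q. w a - (if h s a then w a else 0))"
        by (intro sum.cong) auto
      also have "\<dots> = real (card Q) * w a - real (card {s \<in> Q. h s a}) * w a"
        using assms(1) by (simp add: sum_subtractf flip: sum.inter_filter)
      also have "\<dots> \<le> (1 - q) * real (card Q) * w a"
        using mult_right_mono[OF assms(5)[OF a] assms(4)[OF a]] by (simp add: algebra_simps)
      finally show "(\<Sum>s\<in>Q. if h s a then 0 else w a) \<le> (1 - q) * real (card Q) * w a" .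
    qed
    also have "\<dots> = (\<Sum>s\<in>Q. (1 - q) * (\<Sum>a\<in>C. w a))"
      by (simp add: sum_distrib_left algebra_simps)
    finally show False by simp
  qed
  then show ?thesis using that by blast
qed


text \<open>
  Method of conditional expectations: the total weight of the objects not hit so far, each discounted
  by \<open>1 - q\<close> for every skipped step, shrinks by the factor \<open>1 - q\<close> in every step.
\<close>

lemma greedy_hitting_sequence:
  fixes q :: real and hit :: "nat \<Rightarrow> 's \<Rightarrow> 'a \<Rightarrow> bool" and skip :: "nat \<Rightarrow> 'a \<Rightarrow> bool"
  assumes Q: "finite Q" "Q \<noteq> {}" and C: "finite C" and q: "0 \<le> q" "q < 1"
    and hit: "\<And>k a. k < N \<Longrightarrow> a \<in> C \<Longrightarrow> \<not> skip k a \<Longrightarrow>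
      q * real (card Q) \<le> real (card {s \<in> Q. hit k s a})"
    and skip: "\<And>a. a \<in> C \<Longrightarrow> card {k. k < N \<and> skip k a} \<le> n"
    and bound: "(1 - q) ^ N * real (card C) < (1 - q) ^ n"
  shows "\<exists>S. (\<forall>k. S k \<in> Q) \<and> (\<forall>a\<in>C. \<exists>k<N. hit k (S k) a)"
proof -
  define w where "w k a = (1 - q) ^ card {i. i < k \<and> skip i a}" for k a
  define alive where "alive S k = {a \<in> C. \<forall>i<k. \<not> hit i (S i) a}" for S k
  have w0: "0 \<le> w k a" for k a using q by (simp add: w_def)
  have w_Suc: "w (Suc k) a = (if skip k a then (1 - q) * w k a else w k a)" for k a
  proof -
    have "{i. i < Suc k \<and> skip i a} =
        (if skip k a then insert k {i. i < k \<and> skip i a} else {i. i < k \<and> skip i a})"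
      by (auto simp: less_Suc_eq)
    then show ?thesis by (simp add: w_def)
  qed
  have "\<exists>S. (\<forall>i. S i \<in> Q) \<and> (\<Sum>a\<in>alive S k. w k a) \<le> (1 - q) ^ k * real (card C)" if "k \<le> N" for k
    using that
  proof (induction k)
    case 0
    obtain s where "s \<in> Q" using Q by blast
    then show ?case by (intro exI[of _ "\<lambda>_. s"]) (simp add: alive_def w_def)
  next
    case (Suc k)
    then obtain S where S: "\<forall>i. S i \<in> Q"
      "(\<Sum>a\<in>alive S k. w k a) \<le> (1 - q) ^ k * real (card C)" by auto
    define C1 where "C1 = {a \<in> alive S k. skip k a}"
    define C2 where "C2 = {a \<in> alive S k. \<not> skip k a}"
    have fin: "finite C1" "finite C2" using C by (auto simp: C1_def C2_def alive_def)
    obtain s where s: "s \<in> Q"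
      "(\<Sum>a\<in>{a \<in> C2. \<not> hit k s a}. w k a) \<le> (1 - q) * (\<Sum>a\<in>C2. w k a)"
      using exists_below_average[of Q C2 "w k" q "hit k"] Q fin w0 hit Suc.prems
      by (auto simp: C2_def alive_def)
    let ?S = "S(k := s)"
    \<comment> \<open>Skipped objects may all survive, but their weight picks up a factor
      \<open>1 - q\<close>; for the others the choice of \<open>s\<close> yields the same
      factor.\<close>
    have "alive ?S (Suc k) \<subseteq> C1 \<union> {a \<in> C2. \<not> hit k s a}"
      by (auto simp: alive_def C1_def C2_def less_Suc_eq)
    then have "(\<Sum>a\<in>alive ?S (Suc k). w (Suc k) a)
        \<le> (\<Sum>a\<in>C1 \<union> {a \<in> C2. \<not> hit k s a}. w (Suc k) a)"
      using fin w0 by (intro sum_mono2) auto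
    also have "\<dots> = (\<Sum>a\<in>C1. w (Suc k) a) + (\<Sum>a\<in>{a \<in> C2. \<not> hit k s a}. w (Suc k) a)"
      using fin by (intro sum.union_disjoint finite_Collect_conjI) (auto simp: C1_def C2_def)
    also have "\<dots> = (1 - q) * (\<Sum>a\<in>C1. w k a) + (\<Sum>a\<in>{a \<in> C2. \<not> hit k s a}. w k a)"
      by (simp add: w_Suc C1_def C2_def sum_distrib_left)
    also have "\<dots> \<le> (1 - q) * ((\<Sum>a\<in>C1. w k a) + (\<Sum>a\<in>C2. w k a))"
      using s(2) by (simp add: algebra_simps)
    also have "(\<Sum>a\<in>C1. w k a) + (\<Sum>a\<in>C2. w k a) = (\<Sum>a\<in>alive S k. w k a)"
    proof -
      have "alive S k = C1 \<union> C2" "C1 \<inter> C2 = {}" by (auto simp: C1_def C2_def)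
      then show ?thesis using fin by (simp add: sum.union_disjoint)
    qed
    also have "(1 - q) * \<dots> \<le> (1 - q) * ((1 - q) ^ k * real (card C))"
      using S(2) q by (intro mult_left_mono) auto
    finally show ?case using S(1) s(1) by (intro exI[of _ ?S]) auto
  qed
  then obtain S where S: "\<forall>i. S i \<in> Q" "(\<Sum>a\<in>alive S N. w N a) \<le> (1 - q) ^ N * real (card C)"
    by blast
  have "\<exists>k<N. hit k (S k) a" if a: "a \<in> C" for a
  proof (rule ccontr)
    assume "\<not> ?thesis"
    then have "a \<in> alive S N" using a by (simp add: alive_def)
    then have "w N a \<le> (\<Sum>a\<in>alive S N. w N a)"
      using C w0 by (intro member_le_sum) (auto simp: alive_def)
    \<comment> \<open>A survivor has been skipped at most \<open>n\<close> times, so its weight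
      alone exceeds what \<open>bound\<close> leaves for the total.\<close>
    moreover have "(1 - q) ^ n \<le> w N a"
      unfolding w_def using q skip[OF a] by (intro power_decreasing) auto
    ultimately show False using S(2) bound by linarith
  qed
  then show ?thesis using S(1) by blast
qed

text \<open>Node \<open>v\<close> is active during the rounds \<open>s v, \<dots>, f v - 1\<close>.\<close>

definition busy :: "nat \<Rightarrow> (nat \<Rightarrow> nat) \<Rightarrow> (nat \<Rightarrow> nat) \<Rightarrow> nat \<Rightarrow> nat set" where
  "busy n s f k = {v. v < n \<and> s v \<le> k \<and> k < f v}"

text \<open>
  A node isolated in round \<open>k\<close> is supposed to be inactive from then on. The schedule defeats all
  patterns of activity that contradict this.
\<close>

definition isolating_schedule :: "nat \<Rightarrow> nat \<Rightarrow> (nat \<Rightarrow> nat set) \<Rightarrow> bool" where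
  "isolating_schedule n N S \<longleftrightarrow> (\<forall>s f. (\<forall>k<N. busy n s f k \<noteq> {}) \<longrightarrow>
     (\<exists>k<N. \<exists>u. S k \<inter> busy n s f k = {u} \<and> Suc k < f u))"

section \<open>Length of a schedule that defeats all activity patterns\<close>

lemma one_minus_inverse_power_le_half:
  fixes m :: nat
  assumes "1 \<le> m"
  shows "(1 - 1 / real m) ^ m \<le> 1 / 2"
proof -
  have "1 - 1 / real m \<le> exp (- (1 / real m))"
    using exp_ge_add_one_self[of "- (1 / real m)"] by simp
  then have "(1 - 1 / real m) ^ m \<le> exp (- (1 / real m)) ^ m"
    using assms by (intro power_mono) auto
  also have "\<dots> = exp (- 1)"
    using assms by (simp flip: exp_of_nat_mult)
  also have "\<dots> \<le> 1 / 2"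
    using exp_ge_add_one_self[of 1] by (simp add: exp_minus field_simps)
  finally show ?thesis .
qed

text \<open>Start and end times capped at \<open>N + 1\<close> take \<open>N + 2\<close> values, so
  this keeps the number of activity patterns on \<open>n\<close> nodes below
  \<open>(2 ^ (11 * l)) ^ (2 * n)\<close>.\<close>

lemma schedule_length_bound:
  fixes n l :: nat
  assumes "1 \<le> l" "n \<le> 2 ^ l"
  shows "n + 176 * n * l\<^sup>2 + 2 < 2 ^ (11 * l)"
proof -
  have l: "l \<le> 2 ^ l" by (simp add: less_imp_le)
  have "l\<^sup>2 \<le> (2 ^ l)\<^sup>2" using l by (intro power_mono) auto
  then have "n * l\<^sup>2 \<le> 2 ^ l * (2 ^ l)\<^sup>2" using assms(2) by (rule mult_le_mono[rotated])
  then have 1: "n * l\<^sup>2 \<le> 2 ^ (3 * l)"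
    by (simp add: power2_eq_square power_mult[symmetric] mult.commute[of 3] eval_nat_numeral power_add algebra_simps)
  have 2: "n \<le> 2 ^ (3 * l)" using assms(2) by (rule order_trans) (simp add: power_increasing)
  have 3: "(1::nat) \<le> 2 ^ (3 * l)" by simp
  have "n + 176 * n * l\<^sup>2 + 2 < 256 * 2 ^ (3 * l)" using 1 2 3 unfolding mult.assoc by linarith
  also have "\<dots> = (2::nat) ^ (8 + 3 * l)" by (simp add: power_add)
  also have "\<dots> \<le> 2 ^ (11 * l)" using assms(1) by (intro power_increasing) auto
  finally show ?thesis .
qed

text \<open>The union bound in derandomised form: the objects to be hit are the activity patterns,
  and \<open>q = 1 / (8 * l)\<close> is the success frequency of a random sample.\<close>

lemma isolating_schedule_exists:
  fixes n l :: nat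
  assumes "1 \<le> n" "2 * n \<le> 2 ^ l"
  shows "\<exists>S. isolating_schedule n (n + 176 * n * l\<^sup>2) S"
proof -
  define N where "N = n + 176 * n * l\<^sup>2"
  define q where "q = 1 / real (8 * l)"
  have l: "1 \<le> l" using assms by (cases l) auto
  have q: "0 < q" "q < 1" using l by (auto simp: q_def)
  define Fn where "Fn = {..<n} \<rightarrow>\<^sub>E {..N + 1}"
  define C where "C = {a \<in> Fn \<times> Fn. \<forall>k<N. busy n (fst a) (snd a) k \<noteq> {}}"
  \<comment> \<open>A node isolated in the last round of its activity contradicts nothing, so rounds
    in which some activity ends are skipped. Each node ends once, which gives at most
    \<open>n\<close> of them.\<close>
  define skip where "skip k a \<longleftrightarrow> (\<exists>u<n. snd a u = Suc k)" for k and a :: "(nat \<Rightarrow> nat) \<times> (nat \<Rightarrow> nat)"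
  define hit where "hit k s a \<longleftrightarrow>
      (\<exists>u. sample_set n l s \<inter> busy n (fst a) (snd a) k = {u} \<and> Suc k < snd a u)"
    for k s and a :: "(nat \<Rightarrow> nat) \<times> (nat \<Rightarrow> nat)"
  have finFn: "finite Fn" by (simp add: Fn_def finite_PiE)
  have finC: "finite C" using finFn by (simp add: C_def)
  have cardC: "real (card C) \<le> real ((N + 2) ^ (2 * n))"
  proof -
    have "card C \<le> card (Fn \<times> Fn)" using finFn by (intro card_mono) (auto simp: C_def)
    also have "\<dots> = (N + 2) ^ n * (N + 2) ^ n"
      by (simp add: card_cartesian_product Fn_def card_PiE)
    finally show ?thesis unfolding mult_2 power_add by (rule of_nat_mono)
  qed
  have "\<exists>S. (\<forall>k. S k \<in> samples n l) \<and> (\<forall>a\<in>C. \<exists>k<N. hit k (S k) a)"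
  proof (rule greedy_hitting_sequence)
    show "finite (samples n l)" by (rule finite_samples)
    have "0 < card (samples n l)" using l by (simp add: card_samples)
    then show "samples n l \<noteq> {}" by auto
    show "finite C" by (rule finC)
    show "0 \<le> q" "q < 1" using q by auto
  next
    fix k a assume k: "k < N" and a: "a \<in> C" and ns: "\<not> skip k a"
    have "busy n (fst a) (snd a) k \<subseteq> {..<n}" by (auto simp: busy_def)
    moreover have "busy n (fst a) (snd a) k \<noteq> {}" using a k by (simp add: C_def)
    ultimately have "q * real (card (samples n l))
        \<le> real (card {s \<in> samples n l. isolates (sample_set n l s) (busy n (fst a) (snd a) k)})"
      using isolating_samples_count[OF _ _ assms(2)] by (simp add: q_def)
    also have "\<dots> \<le> real (card {s \<in> samples n l. hit k s a})"
    proof (intro of_nat_mono card_mono)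
      show "finite {s \<in> samples n l. hit k s a}" using finite_samples by simp
      show "{s \<in> samples n l. isolates (sample_set n l s) (busy n (fst a) (snd a) k)}
          \<subseteq> {s \<in> samples n l. hit k s a}"
      proof (intro Collect_mono impI conjI; elim conjE)
        fix s assume "isolates (sample_set n l s) (busy n (fst a) (snd a) k)"
        then obtain u where u: "sample_set n l s \<inter> busy n (fst a) (snd a) k = {u}"
        by (auto simp: isolates_def)
        then have "u < n" "k < snd a u" by (auto simp: busy_def)
        then have "Suc k < snd a u" using ns by (auto simp: skip_def intro: le_neq_implies_less)
        then show "hit k s a" using u by (auto simp: hit_def)
      qed
    qed
    finally show "q * real (card (samples n l)) \<le> real (card {s \<in> samples n l. hit k s a})" .
  next
    fix a assume "a \<in> C"
    have "{k. k < N \<and> skip k a} \<subseteq> (\<lambda>u. snd a u - 1) ` {..<n}"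
      by (force simp: skip_def)
    then have "card {k. k < N \<and> skip k a} \<le> card {..<n}" by (rule surj_card_le[rotated]) simp
    then show "card {k. k < N \<and> skip k a} \<le> n" by simp
  next
    \<comment> \<open>Every \<open>8 * l\<close> rounds halve the weight, and
      \<open>176 * n * l ^ 2\<close> rounds make \<open>22 * n * l\<close> such batches, enough
      against the number of patterns. The further \<open>n\<close> rounds in \<open>N\<close> pay
      for the skipped ones.\<close>
    have "(1 - q) ^ (8 * l) \<le> 1 / 2"
      unfolding q_def using l by (intro one_minus_inverse_power_le_half) auto
    then have "((1 - q) ^ (8 * l)) ^ (22 * n * l) \<le> (1 / 2) ^ (22 * n * l)"
      using q by (intro power_mono) auto
    moreover have "8 * l * (22 * n * l) = 176 * n * l\<^sup>2" by (simp add: power2_eq_square)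
    ultimately have pow: "(1 - q) ^ (176 * n * l\<^sup>2) \<le> 1 / 2 ^ (22 * n * l)"
      by (simp add: power_mult[symmetric] power_one_over)
    have "n \<le> 2 ^ l" using assms by linarith
    then have "N + 2 < 2 ^ (11 * l)" using schedule_length_bound[OF l] by (simp add: N_def)
    then have "(N + 2) ^ (2 * n) < (2 ^ (11 * l)) ^ (2 * n)"
      using assms(1) by (intro power_strict_mono) auto
    also have "\<dots> = 2 ^ (22 * n * l)" by (simp add: power_mult[symmetric] algebra_simps)
    finally have "real ((N + 2) ^ (2 * n)) < real (2 ^ (22 * n * l))" by (rule of_nat_less_iff[THEN iffD2])
    with cardC have "real (card C) < real (2 ^ (22 * n * l))" by linarith
    then have "real (card C) < 2 ^ (22 * n * l)" by simp
    have "(1 - q) ^ (176 * n * l\<^sup>2) * real (card C) \<le> 1 / 2 ^ (22 * n * l) * real (card C)"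
      using pow by (intro mult_right_mono) auto
    also have "\<dots> < 1" using \<open>real (card C) < 2 ^ (22 * n * l)\<close> by simp
    finally have "(1 - q) ^ n * ((1 - q) ^ (176 * n * l\<^sup>2) * real (card C)) < (1 - q) ^ n * 1"
      using q by (intro mult_strict_left_mono) auto
    then show "(1 - q) ^ N * real (card C) < (1 - q) ^ n"
      by (simp add: N_def power_add mult.assoc)
  qed
  then obtain S where S: "\<And>a. a \<in> C \<Longrightarrow> \<exists>k<N. hit k (S k) a" by blast
  have "isolating_schedule n N (\<lambda>k. sample_set n l (S k))"
    unfolding isolating_schedule_def
  proof (intro allI impI)
    fix s f assume nonempty: "\<forall>k<N. busy n s f k \<noteq> {}"
    \<comment> \<open>Capping makes the set of patterns finite and leaves the activity in rounds
      below \<open>N\<close> unchanged.\<close>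
    define cap where "cap g = restrict (\<lambda>v. min (g v) (N + 1)) {..<n}" for g :: "nat \<Rightarrow> nat"
    have busy_cap: "busy n (cap s) (cap f) k = busy n s f k" if "k < N" for k
      using that by (auto simp: busy_def cap_def)
    have "(cap s, cap f) \<in> C"
      using nonempty busy_cap by (auto simp: C_def Fn_def cap_def)
    from S[OF this] obtain k u where k: "k < N"
      and u: "sample_set n l (S k) \<inter> busy n s f k = {u}" "Suc k < cap f u"
      using busy_cap by (auto simp: hit_def)
    have "u < n" using u(1) by (auto simp: busy_def)
    then have "Suc k < f u" using u(2) by (simp add: cap_def)
    then show "\<exists>k<N. \<exists>u. sample_set n l (S k) \<inter> busy n s f k = {u} \<and> Suc k < f u"
      using k u(1) by blast
  qed
  then show ?thesis unfolding N_def by blast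
qed

subsection \<open>The protocol\<close>

definition lg :: "nat \<Rightarrow> nat" where
  "lg n = nat \<lceil>log 2 (real n)\<rceil>"

lemma le_two_power_lg: "n \<le> 2 ^ lg n"
proof (cases "n = 0")
  case False
  have "log 2 (real n) \<le> real (lg n)" unfolding lg_def by linarith
  then have "2 powr log 2 (real n) \<le> 2 powr real (lg n)" by simp
  then have "real n \<le> 2 ^ lg n" using False by (simp add: powr_realpow)
  then show ?thesis by (metis of_nat_le_iff of_nat_numeral of_nat_power)
qed simp

text \<open>The length from \<open>isolating_schedule_exists\<close> with
  \<open>l = Suc (lg n)\<close>; the successor ensures \<open>2 * n \<le> 2 ^ l\<close>.\<close>

definition gather_length :: "nat \<Rightarrow> nat" where
  "gather_length n = n + 176 * n * (Suc (lg n))\<^sup>2"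

text \<open>The choice depends on \<open>n\<close> alone, so all nodes agree on it without
  communication.\<close>

definition sched :: "nat \<Rightarrow> nat \<Rightarrow> nat set" where
  "sched n = (SOME S. isolating_schedule n (gather_length n) S)"

lemma isolating_schedule_sched:
  assumes "1 \<le> n"
  shows "isolating_schedule n (gather_length n) (sched n)"
  unfolding sched_def gather_length_def
  using isolating_schedule_exists[of n "Suc (lg n)"] assms le_two_power_lg[of n]
  by (intro someI_ex[of "isolating_schedule n (n + 176 * n * (Suc (lg n))\<^sup>2)"]) simp

text \<open>
  Steps \<open>0, \<dots>, 2 n - 1\<close> are two rounds in which the nodes transmit one by one. In step
  \<open>ask n j u\<close> node \<open>u\<close> announces the \<open>j\<close> low-order bits of its future parent, and in the step after it
  the out-neighbours answer whether bit \<open>j\<close> can be 0. Gathering begins at step \<open>start n\<close>, in rounds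
  of two steps: a transmission and its repetition against the refusals.

  The argument \<open>ob\<close> maps each step to the observation made in it.
\<close>

definition ask :: "nat \<Rightarrow> nat \<Rightarrow> nat \<Rightarrow> nat" where
  "ask n j u = 2 * n + 2 * (j * n + u)"

definition start :: "nat \<Rightarrow> nat" where
  "start n = ask n (Suc (lg n)) 0"

definition cand :: "nat \<Rightarrow> nat \<Rightarrow> (nat \<Rightarrow> observation) \<Rightarrow> nat \<Rightarrow> nat" where
  "cand n u ob j = (\<Sum>i<j. if ob (Suc (ask n i u)) = Ack True then 0 else 2 ^ i)"

definition gets :: "(nat \<Rightarrow> observation) \<Rightarrow> nat \<Rightarrow> nat list \<Rightarrow> bool" where
  "gets ob i c \<longleftrightarrow> (\<exists>m. ob i = Received m \<and> content m = c)"

text \<open>In step \<open>u\<close> an out-neighbour hears \<open>u\<close>; in step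
  \<open>n + w\<close> it hears the list of in-neighbours of its own in-neighbour
  \<open>w\<close>.\<close>

definition seems_nearest :: "nat \<Rightarrow> (nat \<Rightarrow> observation) \<Rightarrow> nat \<Rightarrow> bool" where
  "seems_nearest n ob u \<longleftrightarrow>
     (\<exists>m. ob u = Received m) \<and> (\<forall>w<n. \<forall>m. ob (n + w) = Received m \<longrightarrow> u \<notin> set (content m))"

text \<open>A child \<open>u\<close> makes itself known by announcing \<open>[v]\<close> in block
  \<open>lg n\<close>, when all bits are determined. The content \<open>[u, v]\<close> marks data
  sent by \<open>u\<close> to its parent \<open>v\<close>.\<close>

definition ready :: "nat \<Rightarrow> nat \<Rightarrow> (nat \<Rightarrow> observation) \<Rightarrow> nat \<Rightarrow> bool" where
  "ready n v ob k \<longleftrightarrow>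
     (\<forall>u<n. gets ob (ask n (lg n) u) [v] \<longrightarrow> (\<exists>i. start n \<le> i \<and> i < k \<and> gets ob i [u, v]))"

text \<open>Only an acknowledgement of the repetition counts, since only there do the other
  receivers refuse. The first conjunct excludes an acknowledged refusal.\<close>

definition finished :: "nat \<Rightarrow> (nat \<Rightarrow> observation) \<Rightarrow> nat \<Rightarrow> bool" where
  "finished n ob r \<longleftrightarrow>
     (\<exists>i<r. (\<exists>b. ob (start n + 2 * i) = Ack b) \<and> ob (Suc (start n + 2 * i)) = Ack True)"

text \<open>A number below \<open>2 ^ j\<close> equals \<open>v mod 2 ^ Suc j\<close> exactly if the
  low \<open>j\<close> bits of \<open>v\<close> agree with it and bit \<open>j\<close> of
  \<open>v\<close> is 0. Refusals in the gathering phase have content \<open>[]\<close>, which no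
  data message has. The rumor set \<open>UNIV\<close> is cut down to the held rumors by
  \<open>sent\<close>.\<close>

definition act :: "nat \<Rightarrow> nat \<Rightarrow> (nat \<Rightarrow> observation) \<Rightarrow> nat \<Rightarrow> action" where
  "act n v ob k =
    (if k < n then if k = v then Transmit (Message {} []) else Receive
     else if k < 2 * n then
       if k = n + v then Transmit (Message {} (filter (\<lambda>u. \<exists>m. ob u = Received m) [0..<n]))
       else Receive
     else if k < start n then
       let j = (k - 2 * n) div 2 div n; u = (k - 2 * n) div 2 mod n in
       if v = u then Transmit (Message {} [cand n v ob j])
       else if odd k \<and> (\<exists>m. ob (k - 1) = Received m \<and>
           \<not> (seems_nearest n ob u \<and> content m = [v mod 2 ^ Suc j]))
         then Transmit (Message {} []) else Receive
     else if even k then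
       if v \<in> sched n ((k - start n) div 2) \<and> ready n v ob k \<and> \<not> finished n ob ((k - start n) div 2)
       then Transmit (Message UNIV [v, cand n v ob (lg n)]) else Receive
     else if \<exists>b. ob (k - 1) = Ack b then Transmit (Message UNIV [v, cand n v ob (lg n)])
     else if \<exists>m. ob (k - 1) = Received m \<and> (\<forall>u. content m \<noteq> [u, v])
       then Transmit (Message {} []) else Receive)"

definition gather :: protocol where
  "gather n v h = act n v (nth h) (length h)"

section \<open>Causality of the protocol\<close>

lemma cand_cong:
  assumes "\<And>i. i < j \<Longrightarrow> f (Suc (ask n i u)) = g (Suc (ask n i u))"
  shows "cand n u f j = cand n u g j"
  unfolding cand_def by (intro sum.cong) (auto simp: assms)

lemma ask_mono: "i < j \<Longrightarrow> u < n \<Longrightarrow> Suc (ask n i u) < ask n j v"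
proof -
  assume a: "i < j" "u < n"
  then have "Suc i * n \<le> j * n" by (intro mult_le_mono1) auto
  then show ?thesis using a by (simp add: ask_def)
qed

lemma ask_less_start: "j \<le> lg n \<Longrightarrow> u < n \<Longrightarrow> Suc (ask n j u) < start n"
  unfolding start_def by (rule ask_mono) auto

lemma twice_le_start: "2 * n \<le> start n"
  by (simp add: start_def ask_def)

lemma even_ask [simp]: "even (ask n j u)" and even_start [simp]: "even (start n)"
  by (auto simp: ask_def start_def)

text \<open>An action depends on earlier observations only, so a finite history can be replaced by
  the full observation sequence of a node.\<close>

lemma act_cong:
  assumes fg: "\<And>i. i < k \<Longrightarrow> f i = g i" and v: "v < n"
  shows "act n v f k = act n v g k"
proof -
  consider "k < n" | "n \<le> k" "k < 2 * n" | "2 * n \<le> k" "k < start n" | "start n \<le> k" by linarith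
  then show ?thesis
  proof cases
    case 1 then show ?thesis by (simp add: act_def)
  next
    case 2
    then have "filter (\<lambda>u. \<exists>m. f u = Received m) [0..<n] = filter (\<lambda>u. \<exists>m. g u = Received m) [0..<n]"
      by (intro filter_cong) (auto simp: fg)
    then show ?thesis using 2 by (simp add: act_def)
  next
    case 3
    define u j where "u = (k - 2 * n) div 2 mod n" and "j = (k - 2 * n) div 2 div n"
    have un: "u < n" using v by (simp add: u_def)
    have "k = ask n j u \<or> k = Suc (ask n j u)"
      using 3 by (simp add: ask_def u_def j_def) presburger
    then have c: "cand n u f j = cand n u g j"
      using un by (intro cand_cong fg) (meson ask_mono less_Suc_eq less_trans)
    have s: "seems_nearest n f u = seems_nearest n g u"
      using 3 un by (simp add: seems_nearest_def fg)
    have p: "odd k \<Longrightarrow> f (k - 1) = g (k - 1)" by (intro fg) (auto elim: oddE)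
    show ?thesis using 3 c s p
      by (simp add: act_def Let_def flip: u_def j_def) (metis)
  next
    case 4
    have c: "cand n v f (lg n) = cand n v g (lg n)"
      using 4 v by (intro cand_cong fg) (meson ask_less_start less_imp_le_nat less_le_trans)
    have r: "ready n v f k = ready n v g k"
    proof -
      have "gets f (ask n (lg n) u) = gets g (ask n (lg n) u)" if "u < n" for u
        using 4 that ask_less_start[of "lg n" n u] by (auto simp: gets_def fg fun_eq_iff)
      moreover have "gets f i = gets g i" if "i < k" for i
        using that by (auto simp: gets_def fg fun_eq_iff)
      ultimately show ?thesis unfolding ready_def by metis
    qed
    have "f (start n + 2 * i) = g (start n + 2 * i)"
      "f (Suc (start n + 2 * i)) = g (Suc (start n + 2 * i))" if "i < (k - start n) div 2" for i
      using 4 that by (auto intro!: fg)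
    then have d: "finished n f ((k - start n) div 2) = finished n g ((k - start n) div 2)"
      unfolding finished_def by metis
    have p: "odd k \<Longrightarrow> f (k - 1) = g (k - 1)" by (intro fg) (auto elim: oddE)
    have "\<not> k < n" "\<not> k < 2 * n" using 4 twice_le_start[of n] by auto
    then show ?thesis using 4 c r d p by (simp add: act_def)
  qed
qed

section \<open>Execution on a fixed network\<close>

locale network =
  fixes n :: nat and E :: "(nat \<times> nat) set" and t :: nat
  assumes net: "acyclic_network n E t"
begin

abbreviation "H \<equiv> history gather n E"

definition ob :: "nat \<Rightarrow> nat \<Rightarrow> observation" where
  "ob v k = observe gather n E (H k) v"

definition tx :: "nat \<Rightarrow> nat \<Rightarrow> bool" where
  "tx k v \<longleftrightarrow> transmits gather n (H k) v"

definition hears :: "nat \<Rightarrow> nat \<Rightarrow> nat \<Rightarrow> bool" where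
  "hears k u w \<longleftrightarrow> \<not> tx k w \<and> {x. (x, w) \<in> E \<and> tx k x} = {u}"

lemma edge_less: "(u, v) \<in> E \<Longrightarrow> u < n \<and> v < n"
  and target_less: "t < n"
  and reach: "v < n \<Longrightarrow> (v, t) \<in> E\<^sup>*"
  and acyclic_E: "acyclic E"
  using net by (auto simp: acyclic_network_def)

lemma finite_E: "finite E"
  using net by (auto simp: acyclic_network_def intro: finite_subset)

lemma wf_E: "wf E"
  using finite_E acyclic_E by (rule finite_acyclic_wf)

lemma no_loop: "(v, v) \<notin> E"
  using acyclic_E by (auto simp: acyclic_def)

lemma target_sink: "(t, v) \<notin> E"
proof
  assume a: "(t, v) \<in> E"
  then have "(v, t) \<in> E\<^sup>*" using reach edge_less by blast
  then have "(t, t) \<in> E\<^sup>+" using a by (rule rtrancl_into_trancl2[rotated])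
  then show False using acyclic_E by (simp add: acyclic_def)
qed

lemma H_eq: "H k v = map (ob v) [0..<k]"
  by (induction k) (auto simp: ob_def)

lemma gather_H: "v < n \<Longrightarrow> gather n v (H k v) = act n v (ob v) k"
  unfolding gather_def H_eq by simp (rule act_cong, auto)

lemma sent_H: "v < n \<Longrightarrow> sent gather n (H k) v = (case act n v (ob v) k of
      Receive \<Rightarrow> None | Transmit m \<Rightarrow> Some (Message (rumors m \<inter> held v (H k v)) (content m)))"
  by (simp add: sent_def gather_H)

lemma tx_iff: "v < n \<Longrightarrow> tx k v \<longleftrightarrow> act n v (ob v) k \<noteq> Receive"
  by (simp add: tx_def transmits_def sent_H split: action.splits)

lemma delivers_iff: "delivers gather n E (H k) u w \<longleftrightarrow> hears k u w"
  by (simp add: delivers_def hears_def tx_def)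

lemma hearsD: "hears k u w \<Longrightarrow> (u, w) \<in> E \<and> tx k u \<and> \<not> tx k w"
  by (auto simp: hears_def)

lemma hears_unique: "hears k u w \<Longrightarrow> hears k u' w \<Longrightarrow> u = u'"
  by (simp add: hears_def)

lemma ob_received_iff:
  "ob v k = Received m \<longleftrightarrow> (\<exists>u. hears k u v \<and> sent gather n (H k) u = Some m)"
proof (cases "\<exists>u. hears k u v")
  case True
  then obtain u where u: "hears k u v" by blast
  have "(THE x. hears k x v) = u" using u hears_unique by (intro the_equality) auto
  moreover obtain m0 where m0: "sent gather n (H k) u = Some m0"
    using hearsD[OF u] by (auto simp: tx_def transmits_def)
  moreover have "\<not> tx k v" using hearsD[OF u] by simp
  ultimately have "ob v k = Received m0"
    using u by (auto simp: ob_def observe_def delivers_iff tx_def)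
  moreover have "(\<exists>x. hears k x v \<and> sent gather n (H k) x = Some m) \<longleftrightarrow> m0 = m"
  proof
    assume "\<exists>x. hears k x v \<and> sent gather n (H k) x = Some m"
    then obtain x where x: "hears k x v" "sent gather n (H k) x = Some m" by blast
    then show "m0 = m" using hears_unique[OF u x(1)] m0 by simp
  next
    assume "m0 = m"
    then show "\<exists>x. hears k x v \<and> sent gather n (H k) x = Some m" using u m0 by blast
  qed
  ultimately show ?thesis by simp
next
  case False
  then show ?thesis by (auto simp: ob_def observe_def delivers_iff)
qed

lemma ob_ack_iff: "ob v k = Ack b \<longleftrightarrow> tx k v \<and> (b \<longleftrightarrow> (\<exists>w. hears k v w))"
  by (auto simp: ob_def observe_def delivers_iff tx_def)

lemma received_transmission:
  assumes "ob v k = Received m"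
  obtains u m' where "hears k u v" "u < n" "act n u (ob u) k = Transmit m'"
    "content m = content m'" "rumors m = rumors m' \<inter> held u (H k u)"
proof -
  obtain u where u: "hears k u v" "sent gather n (H k) u = Some m"
    using assms ob_received_iff by blast
  have "u < n" using u hearsD edge_less by blast
  then show ?thesis using u that[of u] by (auto simp: sent_H split: action.splits)
qed

lemma heard_transmission:
  assumes "hears k u v" "act n u (ob u) k = Transmit m'"
  shows "gets (ob v) k (content m')"
proof -
  have "u < n" using assms hearsD edge_less by blast
  then have "sent gather n (H k) u = Some (Message (rumors m' \<inter> held u (H k u)) (content m'))"
    using assms(2) by (simp add: sent_H)
  then show ?thesis using assms(1) unfolding gets_def ob_received_iff by force
qed

lemma hears_alone:
  assumes "\<And>x. x < n \<Longrightarrow> tx k x \<longleftrightarrow> x = u"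
  shows "hears k x v \<longleftrightarrow> x = u \<and> (u, v) \<in> E"
proof -
  have "{x. (x, v) \<in> E \<and> tx k x} = (if (u, v) \<in> E then {u} else {})"
    using assms edge_less by auto
  moreover have "(u, v) \<in> E \<Longrightarrow> \<not> tx k v" using assms edge_less no_loop by metis
  ultimately show ?thesis by (auto simp: hears_def)
qed

lemma gets_alone:
  assumes "\<And>x. x < n \<Longrightarrow> tx k x \<longleftrightarrow> x = u" "act n u (ob u) k = Transmit m"
  shows "gets (ob v) k c \<longleftrightarrow> (u, v) \<in> E \<and> c = content m"
proof
  assume "gets (ob v) k c"
  then obtain m' where "ob v k = Received m'" "content m' = c" by (auto simp: gets_def)
  then show "(u, v) \<in> E \<and> c = content m"
    using hears_alone[OF assms(1)] assms(2) by (auto elim!: received_transmission)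
next
  assume "(u, v) \<in> E \<and> c = content m"
  then show "gets (ob v) k c"
    using hears_alone[OF assms(1)] heard_transmission[OF _ assms(2), of v] by simp
qed

lemma received_first_round: "u < n \<Longrightarrow> (\<exists>m. ob v u = Received m) \<longleftrightarrow> (u, v) \<in> E"
proof -
  assume u: "u < n"
  have "gets (ob v) u c \<longleftrightarrow> (u, v) \<in> E \<and> c = []" for c
    using gets_alone[of u u "Message {} []" v c] u by (simp add: tx_iff act_def)
  then show ?thesis unfolding gets_def by metis
qed

lemma gets_second_round:
  assumes "w < n"
  shows "gets (ob v) (n + w) c \<longleftrightarrow> (w, v) \<in> E \<and> c = filter (\<lambda>u. (u, w) \<in> E) [0..<n]"
proof -
  have "filter (\<lambda>u. \<exists>m. ob w u = Received m) [0..<n] = filter (\<lambda>u. (u, w) \<in> E) [0..<n]"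
    by (intro filter_cong) (auto simp: received_first_round)
  then have "act n w (ob w) (n + w) = Transmit (Message {} (filter (\<lambda>u. (u, w) \<in> E) [0..<n]))"
    using assms by (simp add: act_def)
  moreover have "tx (n + w) x \<longleftrightarrow> x = w" if "x < n" for x
    using that assms by (simp add: tx_iff act_def)
  ultimately show ?thesis using gets_alone[of "n + w" w] by simp
qed

section \<open>Nearest out-neighbours and the bitwise search for parents\<close>

definition nearest :: "nat \<Rightarrow> nat \<Rightarrow> bool" where
  "nearest u v \<longleftrightarrow> (u, v) \<in> E \<and> (\<forall>w. (u, w) \<in> E \<longrightarrow> (w, v) \<notin> E)"

lemma seems_nearest_iff:
  assumes "u < n"
  shows "seems_nearest n (ob v) u \<longleftrightarrow> nearest u v"
proof -
  have "(\<forall>m. ob v (n + w) = Received m \<longrightarrow> u \<notin> set (content m)) \<longleftrightarrow>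
      \<not> ((w, v) \<in> E \<and> (u, w) \<in> E)" if "w < n" for w
  proof -
    have "(\<forall>m. ob v (n + w) = Received m \<longrightarrow> u \<notin> set (content m)) \<longleftrightarrow>
        (\<forall>c. gets (ob v) (n + w) c \<longrightarrow> u \<notin> set c)"
      by (auto simp: gets_def)
    then show ?thesis using assms that by (auto simp: gets_second_round)
  qed
  then show ?thesis using assms edge_less
    by (auto simp: seems_nearest_def nearest_def received_first_round)
qed

text \<open>The out-neighbourhood is nonempty because \<open>u\<close> reaches \<open>t\<close>, and
  an \<open>E\<close>-minimal member of it is nearest.\<close>

lemma exists_nearest:
  assumes "u < n" "u \<noteq> t"
  shows "\<exists>v. nearest u v"
proof -
  have "(u, t) \<in> E\<^sup>+" using reach[OF assms(1)] assms(2) by (simp add: rtrancl_eq_or_trancl)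
  then obtain w where "(u, w) \<in> E" by (meson tranclD)
  then obtain v where "v \<in> {v. (u, v) \<in> E}" "\<And>y. (y, v) \<in> E \<Longrightarrow> y \<notin> {v. (u, v) \<in> E}"
    using wfE_min[OF wf_E, of w "{v. (u, v) \<in> E}"] by auto
  then show ?thesis by (auto simp: nearest_def)
qed

lemma ask_decode:
  assumes "u < n"
  shows "(ask n j u - 2 * n) div 2 div n = j" "(ask n j u - 2 * n) div 2 mod n = u"
    "(Suc (ask n j u) - 2 * n) div 2 div n = j" "(Suc (ask n j u) - 2 * n) div 2 mod n = u"
proof -
  have "(ask n j u - 2 * n) div 2 = j * n + u" "(Suc (ask n j u) - 2 * n) div 2 = j * n + u"
    by (auto simp: ask_def)
  then show "(ask n j u - 2 * n) div 2 div n = j" "(ask n j u - 2 * n) div 2 mod n = u"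
    "(Suc (ask n j u) - 2 * n) div 2 div n = j" "(Suc (ask n j u) - 2 * n) div 2 mod n = u"
    using assms by auto
qed

lemma act_ask:
  assumes "u < n" "j \<le> lg n"
  shows "act n v (ob v) (ask n j u) =
    (if v = u then Transmit (Message {} [cand n u (ob u) j]) else Receive)"
proof -
  have "\<not> ask n j u < n" "\<not> ask n j u < 2 * n" by (auto simp: ask_def)
  moreover have "ask n j u < start n" using ask_less_start[OF assms(2,1)] by simp
  ultimately show ?thesis unfolding act_def Let_def ask_decode[OF assms(1)] by simp
qed

lemma gets_ask:
  assumes "u < n" "j \<le> lg n"
  shows "gets (ob v) (ask n j u) c \<longleftrightarrow> (u, v) \<in> E \<and> c = [cand n u (ob u) j]"
proof -
  have "tx (ask n j u) x \<longleftrightarrow> x = u" if "x < n" for x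
    using tx_iff[OF that] act_ask[OF assms, of x] by simp
  moreover have "act n u (ob u) (ask n j u) = Transmit (Message {} [cand n u (ob u) j])"
    using act_ask[OF assms, of u] by simp
  ultimately have "gets (ob v) (ask n j u) c \<longleftrightarrow>
      (u, v) \<in> E \<and> c = content (Message {} [cand n u (ob u) j])"
    by (rule gets_alone)
  then show ?thesis by simp
qed

lemma tx_test:
  assumes "u < n" "j \<le> lg n" "v < n"
  shows "tx (Suc (ask n j u)) v \<longleftrightarrow>
    v = u \<or> (u, v) \<in> E \<and> \<not> (nearest u v \<and> v mod 2 ^ Suc j = cand n u (ob u) j)"
proof -
  have "\<not> Suc (ask n j u) < n" "\<not> Suc (ask n j u) < 2 * n" by (auto simp: ask_def)
  moreover have "Suc (ask n j u) < start n" using ask_less_start[OF assms(2,1)] by simp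
  ultimately have "tx (Suc (ask n j u)) v \<longleftrightarrow> v = u \<or>
      (\<exists>c. gets (ob v) (ask n j u) c \<and> \<not> (nearest u v \<and> c = [v mod 2 ^ Suc j]))"
    unfolding tx_iff[OF assms(3)] act_def Let_def ask_decode[OF assms(1)] seems_nearest_iff[OF assms(1)]
    by (auto simp: gets_def)
  then show ?thesis using assms by (auto simp: gets_ask)
qed

text \<open>
  Nobody who can jam a nearest out-neighbour of \<^term>\<open>u\<close> hears \<^term>\<open>u\<close>, so the acknowledgement
  answers the query exactly.
\<close>

lemma ack_test:
  assumes "u < n" "j \<le> lg n"
  shows "ob u (Suc (ask n j u)) = Ack True \<longleftrightarrow>
    (\<exists>v. nearest u v \<and> v mod 2 ^ Suc j = cand n u (ob u) j)"
proof -
  have "hears (Suc (ask n j u)) u v" if v: "nearest u v" "v mod 2 ^ Suc j = cand n u (ob u) j" for v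
  proof -
    have uv: "(u, v) \<in> E" "v < n" "v \<noteq> u" using v edge_less no_loop by (auto simp: nearest_def)
    have "\<not> tx (Suc (ask n j u)) v" using tx_test[OF assms uv(2)] v uv by simp
    moreover have "{x. (x, v) \<in> E \<and> tx (Suc (ask n j u)) x} = {u}"
      using tx_test[OF assms] v uv edge_less by (auto simp: nearest_def)
    ultimately show ?thesis by (simp add: hears_def)
  qed
  \<comment> \<open>Conversely, a receiver is not transmitting, so it did not refuse and must
    satisfy the query.\<close>
  moreover have "nearest u v \<and> v mod 2 ^ Suc j = cand n u (ob u) j"
    if "hears (Suc (ask n j u)) u v" for v
    using hearsD[OF that] tx_test[OF assms] edge_less by blast
  ultimately show ?thesis using tx_test[OF assms assms(1)] by (auto simp: ob_ack_iff)
qed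

text \<open>If bit \<open>j\<close> cannot be 0 for any nearest out-neighbour matching the bits
  found so far, it is 1 for the one supplied by the induction hypothesis.\<close>

lemma cand_invariant:
  assumes "u < n" "u \<noteq> t" "j \<le> lg n"
  shows "\<exists>v. nearest u v \<and> v mod 2 ^ j = cand n u (ob u) j"
  using assms(3)
proof (induction j)
  case 0
  then show ?case using exists_nearest[OF assms(1,2)] by (simp add: cand_def)
next
  case (Suc j)
  then obtain v where v: "nearest u v" "v mod 2 ^ j = cand n u (ob u) j" by auto
  have ack: "ob u (Suc (ask n j u)) = Ack True \<longleftrightarrow>
      (\<exists>v. nearest u v \<and> v mod 2 ^ Suc j = cand n u (ob u) j)"
    using Suc.prems assms(1) by (intro ack_test) auto
  show ?case
  proof (cases "ob u (Suc (ask n j u)) = Ack True")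
    case True
    then show ?thesis using ack by (simp add: cand_def)
  next
    case False
    have "v mod 2 ^ Suc j = 2 ^ j * (v div 2 ^ j mod 2) + v mod 2 ^ j"
      using mod_mult2_eq[of v "2 ^ j" 2] by (simp add: mult.commute)
    moreover have "v mod 2 ^ Suc j \<noteq> v mod 2 ^ j" using False ack v by metis
    ultimately have "v mod 2 ^ Suc j = cand n u (ob u) j + 2 ^ j"
      using v(2) by (cases "even (v div 2 ^ j)") (auto simp: odd_iff_mod_2_eq_one)
    then show ?thesis using v(1) False by (auto simp: cand_def)
  qed
qed

text \<open>Meaningful for \<open>u \<noteq> t\<close> only: the sink \<open>t\<close> never gets a
  positive acknowledgement, so all bits of \<open>par t\<close> are 1.\<close>

definition par :: "nat \<Rightarrow> nat" where
  "par u = cand n u (ob u) (lg n)"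

text \<open>Labels are below \<open>2 ^ lg n\<close>, so agreement in the \<open>lg n\<close>
  low-order bits is equality.\<close>

lemma nearest_par:
  assumes "u < n" "u \<noteq> t"
  shows "nearest u (par u)"
proof -
  obtain v where v: "nearest u v" "v mod 2 ^ lg n = par u"
    using cand_invariant[OF assms le_refl] by (auto simp: par_def)
  have "v < 2 ^ lg n" using v(1) edge_less le_two_power_lg[of n] by (auto simp: nearest_def intro: less_le_trans)
  then show ?thesis using v by simp
qed

section \<open>Progress in the gathering phase\<close>

lemma ready_iff:
  "ready n v (ob v) k \<longleftrightarrow>
    (\<forall>u. (u, v) \<in> E \<and> par u = v \<longrightarrow> (\<exists>i. start n \<le> i \<and> i < k \<and> gets (ob v) i [u, v]))"
  using edge_less by (auto simp: ready_def gets_ask par_def)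

lemma ready_mono: "ready n v (ob v) k \<Longrightarrow> k \<le> k' \<Longrightarrow> ready n v (ob v) k'"
  unfolding ready_def by (meson less_le_trans)

lemma finished_mono: "finished n f r \<Longrightarrow> r \<le> r' \<Longrightarrow> finished n f r'"
  unfolding finished_def by (meson less_le_trans)

lemma act_gather_even:
  "act n v (ob v) (start n + 2 * r) =
    (if v \<in> sched n r \<and> ready n v (ob v) (start n + 2 * r) \<and> \<not> finished n (ob v) r
     then Transmit (Message UNIV [v, par v]) else Receive)"
  using twice_le_start[of n] by (auto simp: act_def par_def)

lemma act_gather_odd:
  assumes "v < n"
  shows "act n v (ob v) (Suc (start n + 2 * r)) =
    (if tx (start n + 2 * r) v then Transmit (Message UNIV [v, par v])
     else if \<exists>c. gets (ob v) (start n + 2 * r) c \<and> (\<forall>u. c \<noteq> [u, v])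
       then Transmit (Message {} []) else Receive)"
  using twice_le_start[of n] by (auto simp: act_def par_def ob_ack_iff gets_def)

lemma tx_gather_odd:
  "v < n \<Longrightarrow> tx (Suc (start n + 2 * r)) v \<longleftrightarrow> tx (start n + 2 * r) v \<or>
    (\<exists>c. gets (ob v) (start n + 2 * r) c \<and> (\<forall>u. c \<noteq> [u, v]))"
  by (simp add: tx_iff[of v "Suc (start n + 2 * r)"] act_gather_odd)

lemma act_tx_gather_even:
  "v < n \<Longrightarrow> tx (start n + 2 * r) v \<Longrightarrow>
    act n v (ob v) (start n + 2 * r) = Transmit (Message UNIV [v, par v])"
  by (simp add: tx_iff act_gather_even split: if_splits)

text \<open>Soundness of acknowledgements: whoever receives the repetition has not refused, and the
  only node that then has no reason to refuse is the parent.\<close>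

lemma finished_delivered:
  assumes "finished n (ob u) r" "u < n"
  obtains i where "start n \<le> i" "i < start n + 2 * r" "(u, par u) \<in> E" "gets (ob (par u)) i [u, par u]"
proof -
  obtain r' where r': "r' < r" "tx (start n + 2 * r') u"
    "\<exists>w. hears (Suc (start n + 2 * r')) u w"
    using assms(1) by (auto simp: finished_def ob_ack_iff)
  then obtain w where w: "hears (Suc (start n + 2 * r')) u w" by blast
  let ?k = "start n + 2 * r'"
  have wn: "w < n" and uw: "(u, w) \<in> E" using hearsD[OF w] edge_less by auto
  have quiet: "\<not> tx ?k w" "\<And>c. gets (ob w) ?k c \<Longrightarrow> \<exists>x. c = [x, w]"
    using hearsD[OF w] tx_gather_odd[OF wn] by auto
  \<comment> \<open>All transmissions of the even step are repeated in the odd one, so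
    \<open>w\<close>, which hears only \<open>u\<close> in the latter, heard \<open>u\<close> in the
    former too.\<close>
  have "{x. (x, w) \<in> E \<and> tx ?k x} \<subseteq> {x. (x, w) \<in> E \<and> tx (Suc ?k) x}"
    using tx_gather_odd edge_less by blast
  then have "hears ?k u w" using w quiet(1) uw r'(2) by (auto simp: hears_def)
  then have g: "gets (ob w) ?k [u, par u]"
    using heard_transmission act_tx_gather_even[OF assms(2) r'(2)] by fastforce
  then have "w = par u" using quiet(2) by blast
  then show ?thesis using that[of ?k] g uw r'(1) by simp
qed

text \<open>In the repetition only \<open>u\<close> and its out-neighbours other than the parent
  transmit. None of the latter has an edge to the parent, which is nearest.\<close>

lemma isolated_finishes:
  assumes "u < n" "u \<noteq> t" "\<And>x. x < n \<Longrightarrow> tx (start n + 2 * r) x \<longleftrightarrow> x = u"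
  shows "finished n (ob u) (Suc r)"
proof -
  let ?k = "start n + 2 * r"
  have near: "nearest u (par u)" using nearest_par[OF assms(1,2)] .
  then have up: "(u, par u) \<in> E" and pn: "par u < n" using edge_less by (auto simp: nearest_def)
  have txu: "tx ?k u" using assms by simp
  have g: "gets (ob v) ?k c \<longleftrightarrow> (u, v) \<in> E \<and> c = [u, par u]" for v c
    using gets_alone[OF assms(3) act_tx_gather_even[OF assms(1) txu]] by simp
  have tx': "tx (Suc ?k) v \<longleftrightarrow> v = u \<or> (u, v) \<in> E \<and> v \<noteq> par u" if "v < n" for v
    using tx_gather_odd[OF that] assms(3)[OF that] g by auto
  have "hears (Suc ?k) u (par u)"
    using near up pn tx' edge_less no_loop by (auto simp: hears_def nearest_def)
  then have "ob u (Suc ?k) = Ack True" using tx'[OF assms(1)] by (auto simp: ob_ack_iff)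
  moreover have "\<exists>b. ob u ?k = Ack b" using txu by (simp add: ob_ack_iff)
  ultimately show ?thesis by (auto simp: finished_def)
qed

lemma target_not_finished: "\<not> finished n (ob t) r"
  using target_sink hearsD by (auto simp: finished_def ob_ack_iff)

text \<open>The node \<open>t\<close> never finishes, so there is an \<open>E\<close>-minimal
  unfinished node. All its in-neighbours have finished, hence its children have delivered and it is
  ready.\<close>

lemma exists_active:
  "\<exists>v<n. ready n v (ob v) (start n + 2 * r) \<and> \<not> finished n (ob v) r"
proof -
  have "t \<in> {v. v < n \<and> \<not> finished n (ob v) r}" using target_less target_not_finished by simp
  then obtain v where v0: "v \<in> {v. v < n \<and> \<not> finished n (ob v) r}"
    "\<And>y. (y, v) \<in> E \<Longrightarrow> y \<notin> {v. v < n \<and> \<not> finished n (ob v) r}"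
    by (rule wfE_min[OF wf_E]) blast
  then have v: "v < n" "\<not> finished n (ob v) r" by auto
  have finished_in: "finished n (ob u) r" if "(u, v) \<in> E" for u
    using v0(2)[OF that] edge_less[OF that] by simp
  have "ready n v (ob v) (start n + 2 * r)"
    unfolding ready_iff
  proof (intro allI impI, elim conjE)
    fix u assume u: "(u, v) \<in> E" "par u = v"
    have "u < n" using u edge_less by simp
    with finished_in[OF u(1)] show "\<exists>i\<ge>start n. i < start n + 2 * r \<and> gets (ob v) i [u, v]"
      by (rule finished_delivered) (use u in auto)
  qed
  then show ?thesis using v by blast
qed

text \<open>The times of getting ready and finishing form an activity pattern that is nonempty in
  every round. By the schedule some isolated node stays unfinished, and only \<open>t\<close> can do
  so.\<close>

lemma target_ready: "\<exists>r<gather_length n. ready n t (ob t) (start n + 2 * r)"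
proof -
  define N where "N = gather_length n"
  \<comment> \<open>The defaults stand for an event that does not occur in time;
    \<open>Suc N\<close> makes the description of \<open>f\<close> valid up to \<open>r = N\<close>,
    which \<open>Suc r\<close> can attain below.\<close>
  define s where "s v = (LEAST r. r = N \<or> ready n v (ob v) (start n + 2 * r))" for v
  define f where "f v = (LEAST r. r = Suc N \<or> finished n (ob v) r)" for v
  have s: "s v \<le> r \<longleftrightarrow> ready n v (ob v) (start n + 2 * r)" if "r < N" for r v
  proof
    assume "s v \<le> r"
    moreover have "s v = N \<or> ready n v (ob v) (start n + 2 * s v)"
      unfolding s_def by (rule LeastI[of _ N]) simp
    ultimately show "ready n v (ob v) (start n + 2 * r)"
      using that ready_mono[of v "start n + 2 * s v" "start n + 2 * r"] by auto
  qed (simp add: s_def Least_le)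
  have f: "r < f v \<longleftrightarrow> \<not> finished n (ob v) r" if "r \<le> N" for r v
  proof -
    have "f v = Suc N \<or> finished n (ob v) (f v)"
      unfolding f_def by (rule LeastI[of _ "Suc N"]) simp
    then have "f v \<le> r \<Longrightarrow> finished n (ob v) r" using that finished_mono[of "ob v" "f v" r] by auto
    moreover have "finished n (ob v) r \<Longrightarrow> f v \<le> r" by (simp add: f_def Least_le)
    ultimately show ?thesis by (meson not_le)
  qed
  have busy: "busy n s f r = {v. v < n \<and> ready n v (ob v) (start n + 2 * r) \<and> \<not> finished n (ob v) r}"
    if "r < N" for r
    using s[OF that] f[OF less_imp_le[OF that]] by (simp add: busy_def)
  have "\<forall>r<N. busy n s f r \<noteq> {}"
  proof (intro allI impI)
    fix r assume "r < N"
    then show "busy n s f r \<noteq> {}" using exists_active[of r] by (simp add: busy) blast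
  qed
  then obtain r u where r: "r < N" "sched n r \<inter> busy n s f r = {u}" "Suc r < f u"
    using isolating_schedule_sched[of n] target_less
    unfolding isolating_schedule_def N_def[symmetric]
    by (metis One_nat_def Suc_leI gr_implies_not0 gr_zeroI)
  have un: "u < n" and rdy: "ready n u (ob u) (start n + 2 * r)"
    using r(2) busy[OF r(1)] by auto
  have "tx (start n + 2 * r) x \<longleftrightarrow> x = u" if "x < n" for x
    using that r(2) busy[OF r(1)] by (auto simp: tx_iff act_gather_even)
  moreover have "\<not> finished n (ob u) (Suc r)" using f[of "Suc r" u] r by simp
  ultimately have "u = t" using isolated_finishes un by blast
  then show ?thesis using rdy r(1) N_def by blast
qed

section \<open>Transport of all rumors along the tree of parents\<close>

definition tree :: "(nat \<times> nat) set" where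
  "tree = {(u, par u) |u. u < n \<and> u \<noteq> t}"

lemma tree_subset: "tree \<subseteq> E"
  using nearest_par by (auto simp: tree_def nearest_def)

text \<open>Passing to the parent follows an edge of a finite acyclic graph, so it can only end at
  \<open>t\<close>.\<close>

lemma tree_reaches_target: "y < n \<Longrightarrow> (y, t) \<in> tree\<^sup>*"
proof (induction y rule: wf_induct_rule[OF finite_acyclic_wf_converse[OF finite_E acyclic_E]])
  case (1 y)
  show ?case
  proof (cases "y = t")
    case False
    then have "(y, par y) \<in> tree" using 1 by (auto simp: tree_def)
    moreover have "(par y, t) \<in> tree\<^sup>*" using 1 calculation tree_subset edge_less by blast
    ultimately show ?thesis by (rule converse_rtrancl_into_rtrancl)
  qed simp
qed

text \<open>A two-entry content identifies data, whose first entry is the sender. A repetition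
  inherits readiness from the step before it.\<close>

lemma addressed_message:
  assumes "ob v i = Received m" "content m = [u, v]" "start n \<le> i"
  shows "ready n u (ob u) i \<and> rumors m = held u (H i u)"
proof -
  obtain x m' where x: "x < n" "act n x (ob x) i = Transmit m'"
    "content m = content m'" "rumors m = rumors m' \<inter> held x (H i x)"
    using assms(1) by (rule received_transmission)
  define r where "r = (i - start n) div 2"
  have "i = start n + 2 * r \<or> i = Suc (start n + 2 * r)"
  proof (cases "even (i - start n)")
    case True
    then have "2 * r = i - start n" by (simp add: r_def)
    then show ?thesis using assms(3) by simp
  next
    case False
    then have "Suc (2 * r) = i - start n"
      using odd_two_times_div_two_succ[of "i - start n"] unfolding r_def by simp
    then show ?thesis using assms(3) by linarith
  qed
  then have sender: "m' = Message UNIV [x, par x] \<and> ready n x (ob x) i \<or> content m' = []"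
  proof
    assume i: "i = start n + 2 * r"
    show ?thesis using x(2) unfolding i act_gather_even by (simp split: if_splits)
  next
    assume i: "i = Suc (start n + 2 * r)"
    show ?thesis
    proof (cases "tx (start n + 2 * r) x")
      case True
      then have "ready n x (ob x) (start n + 2 * r)"
        using tx_iff[OF x(1)] act_gather_even[of x r] by metis
      then have "ready n x (ob x) i" by (rule ready_mono) (simp add: i)
      moreover have "m' = Message UNIV [x, par x]"
        using x(2) True unfolding i act_gather_odd[OF x(1)] by simp
      ultimately show ?thesis by simp
    next
      case False
      then show ?thesis using x(2) unfolding i act_gather_odd[OF x(1)] by (auto split: if_splits)
    qed
  qed
  have content: "content m' = [u, v]" using x(3) assms(2) by (rule subst)
  then have "m' = Message UNIV [x, par x]" "ready n x (ob x) i" using sender by auto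
  moreover from this have "x = u" using content by simp
  ultimately show ?thesis using x(4) by simp
qed

text \<open>Induction on time: each child was ready at the earlier step in which its data arrived,
  so that message covered the subtree of the child.\<close>

lemma ready_holds_subtree:
  "ready n v (ob v) k \<Longrightarrow> (y, v) \<in> tree\<^sup>* \<Longrightarrow> y \<in> held v (H k v)"
proof (induction k arbitrary: v rule: less_induct)
  case (less k)
  show ?case
  proof (cases "y = v")
    case True
    then show ?thesis by (simp add: held_def)
  next
    case False
    then obtain u where u: "(y, u) \<in> tree\<^sup>*" "(u, v) \<in> tree"
      using less.prems(2) by (metis rtranclE)
    then have "par u = v" "(u, v) \<in> E" using tree_subset by (auto simp: tree_def)
    then obtain i m where i: "start n \<le> i" "i < k" "ob v i = Received m" "content m = [u, v]"
      using less.prems(1) by (auto simp: ready_iff gets_def)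
    have m: "ready n u (ob u) i" "rumors m = held u (H i u)"
      using addressed_message[OF i(3,4,1)] by auto
    have "y \<in> rumors m" using less.IH[OF i(2) m(1) u(1)] m(2) by simp
    moreover have "Received m \<in> set (H k v)"
      unfolding H_eq set_map using i(2,3) by (intro image_eqI[of _ _ i]) auto
    ultimately show ?thesis by (auto simp: held_def)
  qed
qed

lemma gathers: "gathers_within gather n E t (start n + 2 * gather_length n)"
proof -
  obtain r where r: "r < gather_length n" "ready n t (ob t) (start n + 2 * r)"
    using target_ready by blast
  have "{..<n} \<subseteq> held t (H (start n + 2 * r) t)"
    using ready_holds_subtree[OF r(2)] tree_reaches_target by (simp add: subset_eq)
  moreover have "start n + 2 * r \<le> start n + 2 * gather_length n" using r(1) by simp
  ultimately show ?thesis unfolding gathers_within_def by blast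
qed

end

section \<open>Running time\<close>

lemma running_time_bigo:
  "(\<lambda>n. real (start n + 2 * gather_length n)) \<in> O(\<lambda>n. real n * (log 2 (real n))\<^sup>2)"
\<comment> \<open>For \<open>x = log 2 n \<ge> 1\<close> and
  \<open>L = Suc (lg n) \<le> 3 * x\<close>, the time per node
  \<open>352 * L ^ 2 + 4 + 2 * L\<close> is at most \<open>352 * 9 + 4 + 6 = 3178\<close> times
  \<open>x ^ 2\<close>.\<close>
proof (rule bigoI[where c = 3178])
  show "\<forall>\<^sub>F n in sequentially. norm (real (start n + 2 * gather_length n))
      \<le> 3178 * norm (real n * (log 2 (real n))\<^sup>2)"
    using eventually_ge_at_top[of 2]
  proof eventually_elim
    case (elim n)
    define x where "x = log 2 (real n)"
    have x: "1 \<le> x" using elim by (simp add: x_def le_log_iff)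
    have "real (lg n) \<le> x + 1" unfolding lg_def x_def[symmetric] using x by linarith
    then have l: "real (Suc (lg n)) \<le> 3 * x" using x by simp
    have xx: "x \<le> x\<^sup>2" "1 \<le> x\<^sup>2" using x by (auto simp: power2_eq_square intro: mult_ge1_I)
    have "(real (Suc (lg n)))\<^sup>2 \<le> (3 * x)\<^sup>2" using l by (intro power_mono) auto
    then have "352 * (real (Suc (lg n)))\<^sup>2 + 4 + 2 * real (Suc (lg n)) \<le> 3178 * x\<^sup>2"
      using l xx by (simp add: power_mult_distrib)
    then have "real n * (352 * (real (Suc (lg n)))\<^sup>2 + 4 + 2 * real (Suc (lg n)))
        \<le> real n * (3178 * x\<^sup>2)" by (intro mult_left_mono) auto
    moreover have "real (start n + 2 * gather_length n)
        = real n * (352 * (real (Suc (lg n)))\<^sup>2 + 4 + 2 * real (Suc (lg n)))"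
      by (simp add: start_def ask_def gather_length_def algebra_simps)
    ultimately show ?case by (simp add: x_def abs_mult algebra_simps)
  qed
qed

theorem theorem3:
  "\<exists>(P :: protocol) (T :: nat \<Rightarrow> nat).
     (\<forall>n E t. acyclic_network n E t \<longrightarrow> gathers_within P n E t (T n)) \<and>
     (\<lambda>n. real (T n)) \<in> O(\<lambda>n. real n * (log 2 (real n))\<^sup>2)"
proof (intro exI conjI allI impI)
  show "gathers_within gather n E t (start n + 2 * gather_length n)" if "acyclic_network n E t" for n E t
    using network.gathers[OF network.intro[OF that]] .
qed (rule running_time_bigo)

end
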